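(* Let $H\in(2/3,1)$, $\tilde a\in\mathbb{R}$, $\tilde\sigma>0$, $x_0>0$, and let $B^H=\{B^H_t,t\ge 0\}$ be a fractional Brownian motion with Hurst parameter $H$. Let $X=\{X_t\}$ be the solution of the stochastic differential equation $$dX_t=\tilde a X_t\,dt+\tilde\sigma\sqrt{X_t}\,dB^H_t,\qquad X_0=x_0,$$ considered until the first moment of reaching zero $\tau_0=\inf\{t>0: X_t=0\}$, where $\int_0^t\sqrt{X_s}\,dB^H_s$ is the pathwise limit of Riemann--Stieltjes sums. Put $a=\tilde a/2$ and $\sigma=\tilde\sigma/2$. Then on $[0,\tau_0)$ the process $Y_t=\sqrt{X_t}$ satisfies $$dY_t=aY_t\,dt+\sigma\,dB^H_t,\qquad Y_0=\sqrt{x_0}.$$ That is, on $[0,\tau_0)$ the process $X$ is the square of the fractional Ornstein--Uhlenbeck process with parameters $a,\sigma$ started at $\sqrt{x_0}$.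
   Context: A fractional Brownian motion with Hurst parameter $H\in(0,1)$ is a centered Gaussian process $\{B^H_t,t\ge0\}$ with continuous paths and covariance $\mathsf{E}B^H_tB^H_s=\frac12\left(t^{2H}+s^{2H}-|t-s|^{2H}\right)$. The fractional Ornstein--Uhlenbeck process with parameters $a\in\mathbb{R}$, $\sigma>0$ and initial value $Y_0$ is the solution of $Y_t=Y_0+a\int_0^tY_s\,ds+\sigma B^H_t$, $t\ge0$. A solution of the equation for $X$ is understood pathwise, in integral form $X_t=x_0+\tilde a\int_0^tX_s\,ds+\tilde\sigma\int_0^t\sqrt{X_s}\,dB^H_s$. For $H>2/3$ it is known that this equation has a unique solution until the first moment of reaching zero, that its trajectories are strictly positive before that moment and Hölder continuous of every order less than $H$, and that the integral $\int_0^t\sqrt{X_s}\,dB^H_s$ exists as a pathwise limit of Riemann--Stieltjes sums. *)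

theory Defs
  imports "HOL-Probability.Probability"
begin

text \<open>Normal laws with variance zero (point masses) count as Gaussian; this matters because a
  fractional Brownian motion vanishes almost surely at time zero.\<close>

definition gaussian_rv :: "'w measure \<Rightarrow> ('w \<Rightarrow> real) \<Rightarrow> bool" where
  "gaussian_rv M X \<longleftrightarrow>
     X \<in> borel_measurable M \<and>
     ((\<exists>\<mu> s. s > 0 \<and> distributed M lborel X (normal_density \<mu> s)) \<or>
      (\<exists>\<mu>. AE w in M. X w = \<mu>))"

text \<open>Processes are indexed by \<^typ>\<open>real\<close>; only the times \<open>t \<ge> 0\<close> are constrained.\<close>

definition gaussian_process :: "'w measure \<Rightarrow> (real \<Rightarrow> 'w \<Rightarrow> real) \<Rightarrow> bool" where
  "gaussian_process M B \<longleftrightarrow>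
     (\<forall>T c. finite T \<and> T \<subseteq> {0..} \<longrightarrow> gaussian_rv M (\<lambda>w. \<Sum>t\<in>T. c t * B t w))"

definition fractional_brownian_motion ::
    "'w measure \<Rightarrow> real \<Rightarrow> (real \<Rightarrow> 'w \<Rightarrow> real) \<Rightarrow> bool" where
  "fractional_brownian_motion M H B \<longleftrightarrow>
     prob_space M \<and> 0 < H \<and> H < 1 \<and>
     gaussian_process M B \<and>
     (\<forall>t\<ge>0. prob_space.expectation M (B t) = 0) \<and>
     (\<forall>s\<ge>0. \<forall>t\<ge>0. prob_space.expectation M (\<lambda>w. B t w * B s w) =
        (t powr (2 * H) + s powr (2 * H) - \<bar>t - s\<bar> powr (2 * H)) / 2) \<and>
     (\<forall>w\<in>space M. continuous_on {0..} (\<lambda>t. B t w))"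

text \<open>Riemann--Stieltjes integral of \<open>f\<close> against \<open>g\<close>: the sums converge as the mesh tends to zero,
  with arbitrary tags.  An interval \<open>K\<close> of a tagged division is nonempty and compact, so its
  endpoints are \<^term>\<open>Inf K\<close> and \<^term>\<open>Sup K\<close>.\<close>

definition rs_sum :: "(real \<Rightarrow> real) \<Rightarrow> (real \<Rightarrow> real) \<Rightarrow> (real \<times> real set) set \<Rightarrow> real" where
  "rs_sum f g p = (\<Sum>(x, K)\<in>p. f x * (g (Sup K) - g (Inf K)))"

definition has_rs_integral ::
    "(real \<Rightarrow> real) \<Rightarrow> (real \<Rightarrow> real) \<Rightarrow> real \<Rightarrow> real \<Rightarrow> real \<Rightarrow> bool" where
  "has_rs_integral f g a b I \<longleftrightarrow>
     (\<forall>e>0. \<exists>d>0. \<forall>p. p tagged_division_of {a..b} \<and> (\<forall>(x, K)\<in>p. Sup K - Inf K < d) \<longrightarrow>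
        \<bar>rs_sum f g p - I\<bar> < e)"

text \<open>The value is \<open>\<infinity>\<close> if the path has no zero at positive times.\<close>

definition first_zero :: "(real \<Rightarrow> real) \<Rightarrow> ereal" where
  "first_zero x = Inf (ereal ` {t. 0 < t \<and> x t = 0})"

text \<open>The path \<open>x\<close> is a total function; its values from the first zero on are constrained only by
  the fact that they determine that first zero.\<close>

definition sqrt_sde_path ::
    "real \<Rightarrow> real \<Rightarrow> real \<Rightarrow> (real \<Rightarrow> real) \<Rightarrow> (real \<Rightarrow> real) \<Rightarrow> bool" where
  "sqrt_sde_path a \<sigma> x0 b x \<longleftrightarrow>
     x 0 = x0 \<and>
     continuous_on {t. 0 \<le> t \<and> ereal t < first_zero x} x \<and>
     (\<forall>t. 0 \<le> t \<and> ereal t < first_zero x \<longrightarrow>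
        (\<exists>I. has_rs_integral (\<lambda>s. sqrt (x s)) b 0 t I \<and>
             x t = x0 + a * integral {0..t} x + \<sigma> * I))"

definition sqrt_sde_solution ::
    "'w measure \<Rightarrow> real \<Rightarrow> real \<Rightarrow> real \<Rightarrow> (real \<Rightarrow> 'w \<Rightarrow> real) \<Rightarrow> (real \<Rightarrow> 'w \<Rightarrow> real) \<Rightarrow> bool" where
  "sqrt_sde_solution M a \<sigma> x0 B X \<longleftrightarrow>
     (\<forall>t\<ge>0. X t \<in> borel_measurable M) \<and>
     (AE w in M. sqrt_sde_path a \<sigma> x0 (\<lambda>t. B t w) (\<lambda>t. X t w))"

text \<open>The Langevin equation \<open>dy = a y dt + \<sigma> db\<close> on the time interval \<open>[0, \<tau>)\<close>.\<close>

definition langevin_path ::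
    "real \<Rightarrow> real \<Rightarrow> real \<Rightarrow> (real \<Rightarrow> real) \<Rightarrow> ereal \<Rightarrow> (real \<Rightarrow> real) \<Rightarrow> bool" where
  "langevin_path a \<sigma> y0 b \<tau> y \<longleftrightarrow>
     y 0 = y0 \<and>
     continuous_on {t. 0 \<le> t \<and> ereal t < \<tau>} y \<and>
     (\<forall>t. 0 \<le> t \<and> ereal t < \<tau> \<longrightarrow> y t = y0 + a * integral {0..t} y + \<sigma> * b t)"

definition fractional_OU ::
    "'w measure \<Rightarrow> real \<Rightarrow> real \<Rightarrow> real \<Rightarrow> (real \<Rightarrow> 'w \<Rightarrow> real) \<Rightarrow> (real \<Rightarrow> 'w \<Rightarrow> real) \<Rightarrow> bool" where
  "fractional_OU M a \<sigma> y0 B Y \<longleftrightarrow>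
     (\<forall>t\<ge>0. Y t \<in> borel_measurable M) \<and>
     (AE w in M. langevin_path a \<sigma> y0 (\<lambda>t. B t w) \<infinity> (\<lambda>t. Y t w))"

end

theory Submission
  imports Defs
begin

text \<open>The chain rule for the square root can be proved path by path.
  Let \<open>y = sqrt x > 0\<close>. Existence of the Riemann--Stieltjes integral for all tags gives, as
  in Henstock's lemma, that \<open>\<Sum> \<bar>y \<xi> \<Delta>b - \<integral> y db\<bar>\<close> over the intervals of a partition tends to zero with the
  mesh. Averaging the left and right tags turns the equation for \<open>x = y\<^sup>2\<close> into
  \<open>(y\<^sub>k + y\<^sub>k\<^sub>+\<^sub>1) \<Delta>(y - \<sigma> b) = 2 a \<integral> y\<^sup>2 dt + \<epsilon>\<^sub>k\<close> with \<open>\<Sum> \<bar>\<epsilon>\<^sub>k\<bar>\<close> tending to zero, so no second-order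
  term ever appears; dividing by \<open>y\<^sub>k + y\<^sub>k\<^sub>+\<^sub>1\<close>, which is bounded below on compact intervals before the first
  zero, and summing gives the Langevin equation.\<close>

section \<open>Tagged divisions and a Henstock lemma for Riemann--Stieltjes sums\<close>

lemma rs_sum_Un:
  fixes a b c :: real
  assumes p: "p tagged_division_of {a..b}" and q: "q tagged_division_of {b..c}"
  shows "rs_sum f g (p \<union> q) = rs_sum f g p + rs_sum f g q"
  unfolding rs_sum_def
proof (rule sum.union_inter_neutral)
  show "finite p" "finite q" using p q by auto
  \<comment> \<open>A pair common to both divisions can only carry the point interval
    \<open>{b}\<close>, on which \<open>g\<close> has increment zero, so the union loses
    nothing.\<close>
  show "\<forall>z\<in>p \<inter> q. (case z of (x, K) \<Rightarrow> f x * (g (Sup K) - g (Inf K))) = 0"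
  proof
    fix z assume z: "z \<in> p \<inter> q"
    obtain x K where zK: "z = (x, K)" by fastforce
    have "x \<in> K" "K \<subseteq> {a..b}" using tagged_division_ofD(2,3)[OF p, of x K] z zK by blast+
    moreover have "K \<subseteq> {b..c}" using tagged_division_ofD(3)[OF q, of x K] z zK by blast
    ultimately have "K = {b}" by force
    then show "(case z of (x, K) \<Rightarrow> f x * (g (Sup K) - g (Inf K))) = 0" by (simp add: zK)
  qed
qed

lemma tagged_division_Un_real:
  fixes a b c :: real
  assumes "p tagged_division_of {a..b}" "q tagged_division_of {b..c}" "a \<le> b" "b \<le> c"
  shows "(p \<union> q) tagged_division_of {a..c}"
proof -
  have "{a..b} \<union> {b..c} = {a..c}" using assms by auto
  then show ?thesis
    using tagged_division_Un[OF assms(1,2)] assms(3,4) by (auto simp: interior_atLeastAtMost_real)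
qed

lemma tagged_division_small_mesh_exists:
  fixes a b d :: real
  assumes "d > 0"
  obtains p where "p tagged_division_of {a..b}" "\<forall>(x, K)\<in>p. Sup K - Inf K < d"
proof -
  \<comment> \<open>Both endpoints of an interval lie within \<open>d/3\<close> of its tag, so its
    length is less than \<open>2 * d / 3\<close>.\<close>
  have "gauge (\<lambda>x::real. ball x (d/3))" using assms by auto
  then obtain p where p: "p tagged_division_of {a..b}" "(\<lambda>x. ball x (d/3)) fine p"
    using fine_division_exists_real by blast
  have "Sup K - Inf K < d" if xK: "(x, K) \<in> p" for x K
  proof -
    have K: "x \<in> K" "K \<subseteq> ball x (d/3)" using p xK by (auto dest: fineD)
    obtain u v where uv: "K = {u..v}" using tagged_division_ofD(4)[OF p(1) xK] by auto
    have le: "u \<le> v" using K uv by auto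
    have "u \<in> ball x (d/3)" "v \<in> ball x (d/3)" using K(2) uv le by auto
    then have "\<bar>x - u\<bar> < d / 3" "\<bar>x - v\<bar> < d / 3" by (simp_all add: dist_real_def)
    then have "v - u < d" using assms by linarith
    then show ?thesis using uv le by simp
  qed
  then show ?thesis using p that by blast
qed

text \<open>The one-point division \<open>{(a, {a})}\<close> has mesh and sum zero, so it is
  admissible for every \<open>d\<close>. This supplies the starting value \<open>J a = 0\<close> in
  the next lemma.\<close>

lemma has_rs_integral_degenerate:
  assumes "has_rs_integral f g a a I"
  shows "I = 0"
proof (rule ccontr)
  assume "I \<noteq> 0"
  then obtain d where d: "d > 0" "\<And>p. p tagged_division_of {a..a} \<Longrightarrow> (\<forall>(x, K)\<in>p. Sup K - Inf K < d)
      \<Longrightarrow> \<bar>rs_sum f g p - I\<bar> < \<bar>I\<bar>"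
    using assms unfolding has_rs_integral_def by (metis zero_less_abs_iff)
  show False
    using d(2)[OF tagged_division_of_self_real[of a a a]] d(1) by (simp add: rs_sum_def)
qed

text \<open>To control the errors on a set \<open>S\<close> of grid intervals, keep these intervals
  with their tags and replace the others by fine divisions of negligible error. The mesh stays below
  \<open>d\<close>, so the total error is small. Applying this to the intervals with nonnegative
  error and to their complement bounds the absolute values. One \<open>d\<close> serves all tags,
  hence left and right endpoints alike.\<close>

lemma has_rs_integral_henstock:
  assumes J: "\<And>s. a \<le> s \<Longrightarrow> s \<le> b \<Longrightarrow> has_rs_integral f g a s (J s)" and "a \<le> b" and e: "e > 0"
  shows "\<exists>d>0. \<forall>n t \<xi>. t 0 = a \<and> t n = b \<and>
        (\<forall>k<n. t k \<le> \<xi> k \<and> \<xi> k \<le> t (Suc k) \<and> t (Suc k) - t k < d) \<longrightarrow>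
       (\<Sum>k<n. \<bar>f (\<xi> k) * (g (t (Suc k)) - g (t k)) - (J (t (Suc k)) - J (t k))\<bar>) \<le> e"
proof -
  define small where "small = (\<lambda>d p. \<forall>(x::real, K::real set)\<in>p. Sup K - Inf K < d)"
  have small_sum: "\<exists>d>0. \<forall>p. p tagged_division_of {a..s} \<and> small d p \<longrightarrow> \<bar>rs_sum f g p - J s\<bar> < \<eta>"
    if "a \<le> s" "s \<le> b" "\<eta> > 0" for s \<eta>
    using J[OF that(1,2)] that(3) unfolding has_rs_integral_def small_def by blast
  \<comment> \<open>The bound \<open>e / 3\<close> here and \<open>e / 6\<close> from the refined
    division leave \<open>e / 2\<close> for each of the two signs.\<close>
  obtain d where d: "d > 0" and dI: "\<And>p. p tagged_division_of {a..b} \<Longrightarrow> small d p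
      \<Longrightarrow> \<bar>rs_sum f g p - J b\<bar> < e / 3"
    using small_sum[of b "e / 3"] \<open>a \<le> b\<close> e by auto
  have J0: "J a = 0" using has_rs_integral_degenerate J[of a] \<open>a \<le> b\<close> by blast
  \<comment> \<open>The integral over \<open>{s..u}\<close> is reached by difference: a fine
    division of \<open>{s..u}\<close> is appended to one of \<open>{a..s}\<close>, and the limits
    \<open>J u\<close> and \<open>J s\<close> of the longer and the shorter sum are
    subtracted.\<close>
  have approx: "\<exists>q. q tagged_division_of {s..u} \<and> small d q \<and> \<bar>rs_sum f g q - (J u - J s)\<bar> < \<epsilon>"
    if su: "a \<le> s" "s \<le> u" "u \<le> b" and eps: "\<epsilon> > 0" for s u \<epsilon>
  proof -
    obtain d1 where d1: "d1 > 0" and I1: "\<And>p. p tagged_division_of {a..s} \<Longrightarrow> small d1 p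
        \<Longrightarrow> \<bar>rs_sum f g p - J s\<bar> < \<epsilon> / 2"
      using small_sum[of s "\<epsilon> / 2"] su eps by auto
    obtain d2 where d2: "d2 > 0" and I2: "\<And>p. p tagged_division_of {a..u} \<Longrightarrow> small d2 p
        \<Longrightarrow> \<bar>rs_sum f g p - J u\<bar> < \<epsilon> / 2"
      using small_sum[of u "\<epsilon> / 2"] su eps by auto
    define \<delta> where "\<delta> = min d (min d1 d2)"
    have \<delta>: "\<delta> > 0" using d d1 d2 by (simp add: \<delta>_def)
    have mono: "small d' r" if "small \<delta> r" "\<delta> \<le> d'" for d' r
      using that unfolding small_def by fastforce
    obtain p where p: "p tagged_division_of {a..s}" "small \<delta> p"
      using tagged_division_small_mesh_exists[OF \<delta>, of a s] unfolding small_def by blast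
    obtain q where q: "q tagged_division_of {s..u}" "small \<delta> q"
      using tagged_division_small_mesh_exists[OF \<delta>, of s u] unfolding small_def by blast
    have pq: "(p \<union> q) tagged_division_of {a..u}" "small \<delta> (p \<union> q)"
      using tagged_division_Un_real[OF p(1) q(1)] su p(2) q(2) by (auto simp: small_def)
    have "\<bar>rs_sum f g p - J s\<bar> < \<epsilon> / 2"
      by (intro I1 p mono[OF p(2)]) (simp add: \<delta>_def)
    moreover have "\<bar>rs_sum f g (p \<union> q) - J u\<bar> < \<epsilon> / 2"
      by (intro I2 pq mono[OF pq(2)]) (simp add: \<delta>_def)
    ultimately have "\<bar>rs_sum f g q - (J u - J s)\<bar> < \<epsilon>"
      using rs_sum_Un[OF p(1) q(1), of f g] by linarith
    moreover have "small d q" using mono[OF q(2)] by (simp add: \<delta>_def)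
    ultimately show ?thesis using q by blast
  qed
  have main: "(\<Sum>k<n. \<bar>f (\<xi> k) * (g (t (Suc k)) - g (t k)) - (J (t (Suc k)) - J (t k))\<bar>) \<le> e"
    if t0: "t 0 = a" and tn: "t n = b"
      and grid: "\<And>k. k < n \<Longrightarrow> t k \<le> \<xi> k \<and> \<xi> k \<le> t (Suc k) \<and> t (Suc k) - t k < d"
    for n t \<xi>
  proof -
    define r where "r k = f (\<xi> k) * (g (t (Suc k)) - g (t k)) - (J (t (Suc k)) - J (t k))" for k
    have tmono: "t i \<le> t j" if "i \<le> j" "j \<le> n" for i j
      using that
    proof (induction j)
      case (Suc j)
      then show ?case using grid[of j] by (cases "i = Suc j") auto
    qed auto
    text \<open>Outside \<open>S\<close> the single interval is replaced by a finer division, which makes the error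
      there negligible.\<close>
    have build: "\<exists>p. p tagged_division_of {a..t m} \<and> small d p \<and>
        \<bar>rs_sum f g p - (J (t m) + (\<Sum>k\<in>{..<m} \<inter> S. r k))\<bar> < \<epsilon>"
      if "m \<le> n" "\<epsilon> > 0" for S m \<epsilon>
      using that
    proof (induction m arbitrary: \<epsilon>)
      case 0
      have "{(a, {a..a})} tagged_division_of {a..a}" by (rule tagged_division_of_self_real) simp
      then show ?case
        using 0 d J0 t0 by (intro exI[of _ "{(a, {a..a})}"]) (auto simp: small_def rs_sum_def)
    next
      case (Suc m)
      then obtain p where p: "p tagged_division_of {a..t m}" "small d p"
          "\<bar>rs_sum f g p - (J (t m) + (\<Sum>k\<in>{..<m} \<inter> S. r k))\<bar> < \<epsilon> / 2"
        using Suc.IH[of "\<epsilon> / 2"] by auto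
      have le: "a \<le> t m" "t m \<le> t (Suc m)" "t (Suc m) \<le> b"
        using tmono[of 0 m] tmono[of m "Suc m"] tmono[of "Suc m" n] Suc.prems t0 tn by auto
      obtain q where q: "q tagged_division_of {t m..t (Suc m)}" "small d q"
        "\<bar>rs_sum f g q - (J (t (Suc m)) - J (t m) + (if m \<in> S then r m else 0))\<bar> < \<epsilon> / 2"
      proof (cases "m \<in> S")
        case True
        have "{(\<xi> m, {t m..t (Suc m)})} tagged_division_of {t m..t (Suc m)}"
          using grid[of m] Suc.prems by (intro tagged_division_of_self_real) auto
        then show ?thesis
          using True le grid[of m] Suc.prems
          by (intro that[of "{(\<xi> m, {t m..t (Suc m)})}"]) (auto simp: small_def rs_sum_def r_def)
      next
        case False
        then show ?thesis using approx[OF le, of "\<epsilon> / 2"] Suc.prems that by auto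
      qed
      have "{..<Suc m} \<inter> S = (if m \<in> S then insert m ({..<m} \<inter> S) else {..<m} \<inter> S)"
        by (auto simp: lessThan_Suc)
      then have "(\<Sum>k\<in>{..<Suc m} \<inter> S. r k) = (\<Sum>k\<in>{..<m} \<inter> S. r k) + (if m \<in> S then r m else 0)"
        by auto
      then have "\<bar>rs_sum f g (p \<union> q) - (J (t (Suc m)) + (\<Sum>k\<in>{..<Suc m} \<inter> S. r k))\<bar> < \<epsilon>"
        using p(3) q(3) rs_sum_Un[OF p(1) q(1), of f g] by linarith
      moreover have "small d (p \<union> q)" using p(2) q(2) by (auto simp: small_def)
      ultimately show ?case using tagged_division_Un_real[OF p(1) q(1) le(1,2)] by blast
    qed
    have part: "\<bar>\<Sum>k\<in>{..<n} \<inter> S. r k\<bar> \<le> e / 2" for S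
    proof -
      obtain p where p: "p tagged_division_of {a..b}" "small d p"
          "\<bar>rs_sum f g p - (J b + (\<Sum>k\<in>{..<n} \<inter> S. r k))\<bar> < e / 6"
        using build[of n "e / 6" S] e tn by auto
      then show ?thesis using dI[OF p(1,2)] by linarith
    qed
    have "(\<Sum>k<n. \<bar>r k\<bar>) = (\<Sum>k\<in>{..<n} \<inter> {k. 0 \<le> r k}. \<bar>r k\<bar>) + (\<Sum>k\<in>{..<n} \<inter> - {k. 0 \<le> r k}. \<bar>r k\<bar>)"
      by (subst sum.Int_Diff[of _ _ "{k. 0 \<le> r k}"]) (auto simp: Diff_eq)
    also have "\<dots> = (\<Sum>k\<in>{..<n} \<inter> {k. 0 \<le> r k}. r k) + (\<Sum>k\<in>{..<n} \<inter> - {k. 0 \<le> r k}. - r k)"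
      by (intro arg_cong2[of _ _ _ _ "(+)"] sum.cong) auto
    also have "\<dots> \<le> e"
      using part[of "{k. 0 \<le> r k}"] part[of "- {k. 0 \<le> r k}"] by (simp add: sum_negf)
    finally show ?thesis by (simp add: r_def)
  qed
  show ?thesis using d main by blast
qed

section \<open>The chain rule for the square root along a single path\<close>

lemma integral_grid:
  fixes h :: "real \<Rightarrow> real"
  assumes "continuous_on {t 0..t n} h" "\<And>k. k < n \<Longrightarrow> t k \<le> t (Suc k)"
  shows "integral {t 0..t n} h = (\<Sum>k<n. integral {t k..t (Suc k)} h)"
  using assms
proof (induction n)
  case (Suc n)
  note mono = Suc.prems(2)
  have "t 0 \<le> t m" if "m \<le> n" for m
    using that
  proof (induction m)
    case (Suc k)
    have "t k \<le> t (Suc k)" using Suc.prems by (intro mono) simp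
    then show ?case using Suc by simp
  qed simp
  then have le: "t 0 \<le> t n" "t n \<le> t (Suc n)" using Suc.prems(2) by auto
  have "integral {t 0..t (Suc n)} h = integral {t 0..t n} h + integral {t n..t (Suc n)} h"
    using Henstock_Kurzweil_Integration.integral_combine[OF le integrable_continuous_real[OF Suc.prems(1)]] by simp
  moreover have "continuous_on {t 0..t n} h"
    using Suc.prems(1) le by (auto elim: continuous_on_subset)
  ultimately show ?case using Suc by simp
qed auto

lemma uniform_modulus:
  fixes h :: "real \<Rightarrow> real"
  assumes "continuous_on {a..b} h" "e > 0"
  obtains d where "d > 0" "\<And>s u. s \<in> {a..b} \<Longrightarrow> u \<in> {a..b} \<Longrightarrow> \<bar>s - u\<bar> < d \<Longrightarrow> \<bar>h s - h u\<bar> < e"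
  using compact_uniformly_continuous[OF assms(1)] assms(2)
  unfolding uniformly_continuous_on_def dist_real_def
  by (metis compact_Icc abs_minus_commute)

lemma sqrt_of_rs_equation:
  fixes x b :: "real \<Rightarrow> real"
  assumes "0 \<le> T"
    and cont: "continuous_on {0..T} x"
    and pos: "\<And>t. t \<in> {0..T} \<Longrightarrow> x t > 0"
    and J: "\<And>t. t \<in> {0..T} \<Longrightarrow> has_rs_integral (\<lambda>s. sqrt (x s)) b 0 t (J t)"
    and eq: "\<And>t. t \<in> {0..T} \<Longrightarrow> x t = c + a * integral {0..t} x + \<sigma> * J t"
  shows "sqrt (x T) - sqrt (x 0) = a / 2 * integral {0..T} (\<lambda>s. sqrt (x s)) + \<sigma> / 2 * (b T - b 0)"
proof -
  define y where "y = (\<lambda>s. sqrt (x s))"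
  have ycont: "continuous_on {0..T} y" unfolding y_def by (intro continuous_intros cont)
  have ysq: "x t = (y t)\<^sup>2" if "t \<in> {0..T}" for t using pos[OF that] by (simp add: y_def)
  obtain m where m: "m > 0" "\<And>t. t \<in> {0..T} \<Longrightarrow> m \<le> y t"
  proof -
    obtain s where s: "s \<in> {0..T}" "\<And>t. t \<in> {0..T} \<Longrightarrow> y s \<le> y t"
      using continuous_attains_inf[OF _ _ ycont] \<open>0 \<le> T\<close> by force
    then show ?thesis using that[of "y s"] pos[of s] by (auto simp: y_def)
  qed
  obtain B where B: "B > 0" "\<And>t. t \<in> {0..T} \<Longrightarrow> y t \<le> B"
  proof -
    obtain s where s: "s \<in> {0..T}" "\<And>t. t \<in> {0..T} \<Longrightarrow> y t \<le> y s"
      using continuous_attains_sup[OF _ _ ycont] \<open>0 \<le> T\<close> by force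
    then show ?thesis using that[of "y s"] pos[of s] by (auto simp: y_def)
  qed
  \<comment> \<open>Subtracting the noise from \<open>y\<close> gives \<open>z\<close>; the claim is
    that the defect \<open>L\<close> in its integrated equation vanishes.\<close>
  define z where "z = (\<lambda>s. y s - \<sigma> / 2 * b s)"
  define L where "L = z T - z 0 - a / 2 * integral {0..T} y"
  \<comment> \<open>The local errors add up to
    \<open>\<bar>\<sigma>\<bar> / (4 * m) * (2 * \<eta>)\<close> from the noise and
    \<open>\<bar>a\<bar> * B * \<eta> / (2 * m) * T\<close> from the drift, which is
    \<open>C * \<eta>\<close>.\<close>
  define C where "C = (\<bar>\<sigma>\<bar> + \<bar>a\<bar> * B * T) / (2 * m)"
  have C: "C \<ge> 0" unfolding C_def using m B \<open>0 \<le> T\<close> by simp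
  have bound: "\<bar>L\<bar> \<le> C * \<eta>" if eta: "\<eta> > 0" for \<eta>
  proof -
    obtain d1 where d1: "d1 > 0"
      and H: "\<forall>n t \<xi>. t 0 = 0 \<and> t n = T \<and>
        (\<forall>k<n. t k \<le> \<xi> k \<and> \<xi> k \<le> t (Suc k) \<and> t (Suc k) - t k < d1) \<longrightarrow>
       (\<Sum>k<n. \<bar>y (\<xi> k) * (b (t (Suc k)) - b (t k)) - (J (t (Suc k)) - J (t k))\<bar>) \<le> \<eta>"
      using has_rs_integral_henstock[of 0 T y b J \<eta>] J \<open>0 \<le> T\<close> eta unfolding y_def by auto
    obtain d2 where d2: "d2 > 0"
      and U: "\<And>s u. s \<in> {0..T} \<Longrightarrow> u \<in> {0..T} \<Longrightarrow> \<bar>s - u\<bar> < d2 \<Longrightarrow> \<bar>y s - y u\<bar> < \<eta>"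
      using uniform_modulus[OF ycont eta] by blast
    \<comment> \<open>The strict inequality makes \<open>n\<close> positive even when
      \<open>T = 0\<close>, so division by \<open>n\<close> is harmless.\<close>
    obtain n :: nat where n: "T / min d1 d2 < real n" using reals_Archimedean2 by blast
    have n0: "n > 0" using n d1 d2 \<open>0 \<le> T\<close>
      by (metis divide_nonneg_pos gr0I less_le_not_le min_less_iff_conj of_nat_0)
    define t where "t k = T * (real k / real n)" for k
    have step: "t (Suc k) - t k = T / n" for k by (simp add: t_def field_simps add_divide_distrib)
    have mesh: "T / n < d1" "T / n < d2" using n n0 d1 d2
      by (auto simp: field_simps min_def split: if_splits intro: order_less_le_trans)
    have t0: "t 0 = 0" and tn: "t n = T" using n0 by (auto simp: t_def)
    have inc: "t k \<le> t (Suc k)" for k using step[of k] \<open>0 \<le> T\<close> by (simp add: algebra_simps)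
    have tin: "t k \<in> {0..T}" if "k \<le> n" for k
      using that \<open>0 \<le> T\<close> n0 by (auto simp: t_def field_simps mult_left_mono)
    define db where "db k = b (t (Suc k)) - b (t k)" for k
    define dJ where "dJ k = J (t (Suc k)) - J (t k)" for k
    define S where "S k = y (t k) + y (t (Suc k))" for k
    \<comment> \<open>The left-tag and right-tag errors together dominate
      \<open>S k * db k - 2 * dJ k\<close>; each of them sums to at most
      \<open>\<eta>\<close>.\<close>
    define \<epsilon> where "\<epsilon> k = \<bar>y (t k) * db k - dJ k\<bar> + \<bar>y (t (Suc k)) * db k - dJ k\<bar>" for k
    have eps: "(\<Sum>k<n. \<epsilon> k) \<le> 2 * \<eta>"
    proof -
      have "(\<Sum>k<n. \<bar>y (t k) * db k - dJ k\<bar>) \<le> \<eta>"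
        unfolding db_def dJ_def using t0 tn inc step mesh by (intro H[rule_format]) auto
      moreover have "(\<Sum>k<n. \<bar>y (t (Suc k)) * db k - dJ k\<bar>) \<le> \<eta>"
        unfolding db_def dJ_def using t0 tn inc step mesh by (intro H[rule_format]) auto
      ultimately show ?thesis by (simp add: \<epsilon>_def sum.distrib)
    qed
    have local: "\<bar>z (t (Suc k)) - z (t k) - a / 2 * integral {t k..t (Suc k)} y\<bar>
        \<le> \<bar>\<sigma>\<bar> / (4 * m) * \<epsilon> k + \<bar>a\<bar> * B * \<eta> / (2 * m) * (T / n)" if k: "k < n" for k
    proof -
      have in1: "t k \<in> {0..T}" and in2: "t (Suc k) \<in> {0..T}" using tin k by auto
      have sub: "{t k..t (Suc k)} \<subseteq> {0..T}" using in1 in2 by auto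
      note c = continuous_on_subset[OF cont sub] continuous_on_subset[OF ycont sub]
      have S: "S k \<ge> 2 * m" unfolding S_def using m(2)[OF in1] m(2)[OF in2] by simp
      then have S0: "S k > 0" using m by linarith
      have xint: "integral {0..t (Suc k)} x = integral {0..t k} x + integral {t k..t (Suc k)} x"
        using in1 in2 inc[of k] cont
        by (intro Henstock_Kurzweil_Integration.integral_combine[symmetric] integrable_continuous_real)
          (auto elim: continuous_on_subset)
      \<comment> \<open>The difference of squares factors exactly, so no quadratic remainder in the
        increment of \<open>y\<close> arises.\<close>
      have "S k * (y (t (Suc k)) - y (t k)) = x (t (Suc k)) - x (t k)"
        using ysq[OF in1] ysq[OF in2] by (simp add: S_def power2_eq_square algebra_simps)
      also have "\<dots> = a * integral {t k..t (Suc k)} x + \<sigma> * dJ k"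
        using eq[OF in1] eq[OF in2] xint by (simp add: dJ_def algebra_simps)
      finally have 1: "S k * (z (t (Suc k)) - z (t k))
          = a * integral {t k..t (Suc k)} x - \<sigma> / 2 * (S k * db k - 2 * dJ k)"
        by (simp add: z_def db_def algebra_simps)
      \<comment> \<open>After division by \<open>S k\<close> the drift density
        \<open>x s / S k\<close> is compared with \<open>y s / 2\<close>; they are close because
        \<open>x = y\<^sup>2\<close> and \<open>S k\<close> is close to
        \<open>2 * y s\<close>.\<close>
      have 2: "z (t (Suc k)) - z (t k) - a / 2 * integral {t k..t (Suc k)} y =
         a * integral {t k..t (Suc k)} (\<lambda>s. x s / S k - y s / 2) - \<sigma> / (2 * S k) * (S k * db k - 2 * dJ k)"
      proof -
        have 3: "integral {t k..t (Suc k)} (\<lambda>s. x s / S k - y s / 2)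
            = integral {t k..t (Suc k)} x / S k - integral {t k..t (Suc k)} y / 2"
          using c S0 by (subst Henstock_Kurzweil_Integration.integral_diff)
            (auto intro!: integrable_continuous_real continuous_intros)
        have 4: "z (t (Suc k)) - z (t k)
            = (a * integral {t k..t (Suc k)} x - \<sigma> / 2 * (S k * db k - 2 * dJ k)) / S k"
          using 1 S0 by (simp add: field_simps)
        show ?thesis unfolding 3 4 using S0 by (simp add: field_simps)
      qed
      \<comment> \<open>The difference equals \<open>y s * (2 * y s - S k) / (2 * S k)\<close>.
        Uniform continuity bounds the bracket by \<open>2 * \<eta>\<close>, while \<open>y s\<close>
        is at most \<open>B\<close> and \<open>S k\<close> at least \<open>2 * m\<close>.\<close>
      have "\<bar>x s / S k - y s / 2\<bar> \<le> B * \<eta> / (2 * m)" if s: "s \<in> {t k..t (Suc k)}" for s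
      proof -
        have s': "s \<in> {0..T}" using s sub by auto
        have "\<bar>y s - y (t k)\<bar> < \<eta>" "\<bar>y s - y (t (Suc k))\<bar> < \<eta>"
          using s step[of k] mesh by (auto intro!: U s' in1 in2)
        then have "\<bar>2 * y s - S k\<bar> \<le> 2 * \<eta>" unfolding S_def by linarith
        moreover have "0 < y s" "y s \<le> B" using m(1) m(2)[OF s'] B(2)[OF s'] by linarith+
        ultimately have "y s * \<bar>2 * y s - S k\<bar> \<le> B * (2 * \<eta>)" by (intro mult_mono) auto
        then have "y s * \<bar>2 * y s - S k\<bar> / (2 * S k) \<le> B * (2 * \<eta>) / (2 * (2 * m))"
          using S m B eta S0 by (intro frac_le) auto
        moreover have "x s / S k - y s / 2 = y s * (2 * y s - S k) / (2 * S k)"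
          using ysq[OF s'] S0 by (simp add: field_simps power2_eq_square)
        ultimately show ?thesis using \<open>0 < y s\<close> S0 by (simp add: abs_mult)
      qed
      moreover have "continuous_on {t k..t (Suc k)} (\<lambda>s. x s / S k - y s / 2)"
        using S0 by (intro continuous_intros c) auto
      ultimately have "\<bar>integral {t k..t (Suc k)} (\<lambda>s. x s / S k - y s / 2)\<bar> \<le> B * \<eta> / (2 * m) * (T / n)"
        using integral_bound[of "t k" "t (Suc k)" "\<lambda>s. x s / S k - y s / 2" "B * \<eta> / (2 * m)"]
          inc[of k] step[of k] by auto
      then have 3: "\<bar>a * integral {t k..t (Suc k)} (\<lambda>s. x s / S k - y s / 2)\<bar>
          \<le> \<bar>a\<bar> * (B * \<eta> / (2 * m) * (T / n))"
        unfolding abs_mult by (intro mult_left_mono) auto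
      have "S k * db k - 2 * dJ k = (y (t k) * db k - dJ k) + (y (t (Suc k)) * db k - dJ k)"
        by (simp add: S_def algebra_simps)
      then have "\<bar>S k * db k - 2 * dJ k\<bar> \<le> \<epsilon> k" unfolding \<epsilon>_def by linarith
      moreover have "\<bar>\<sigma>\<bar> / (2 * S k) \<le> \<bar>\<sigma>\<bar> / (4 * m)"
        using S m(1) by (intro frac_le) auto
      ultimately have "\<bar>\<sigma>\<bar> / (2 * S k) * \<bar>S k * db k - 2 * dJ k\<bar> \<le> \<bar>\<sigma>\<bar> / (4 * m) * \<epsilon> k"
        using m(1) by (intro mult_mono) auto
      moreover have "\<bar>\<sigma> / (2 * S k) * (S k * db k - 2 * dJ k)\<bar> = \<bar>\<sigma>\<bar> / (2 * S k) * \<bar>S k * db k - 2 * dJ k\<bar>"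
        using S0 by (simp add: abs_mult)
      moreover have "\<bar>a\<bar> * (B * \<eta> / (2 * m) * (T / n)) = \<bar>a\<bar> * B * \<eta> / (2 * m) * (T / n)" by simp
      ultimately show ?thesis unfolding 2 using 3 by linarith
    qed
    have "L = (\<Sum>k<n. z (t (Suc k)) - z (t k)) - a / 2 * (\<Sum>k<n. integral {t k..t (Suc k)} y)"
      unfolding L_def using integral_grid[of t n y] ycont inc t0 tn
      by (simp add: sum_lessThan_telescope[of "\<lambda>k. z (t k)"])
    then have "L = (\<Sum>k<n. z (t (Suc k)) - z (t k) - a / 2 * integral {t k..t (Suc k)} y)"
      by (simp add: sum_subtractf sum_distrib_left)
    then have "\<bar>L\<bar> \<le> (\<Sum>k<n. \<bar>z (t (Suc k)) - z (t k) - a / 2 * integral {t k..t (Suc k)} y\<bar>)"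
      using sum_abs by simp
    also have "\<dots> \<le> (\<Sum>k<n. \<bar>\<sigma>\<bar> / (4 * m) * \<epsilon> k + \<bar>a\<bar> * B * \<eta> / (2 * m) * (T / n))"
      using local by (intro sum_mono) auto
    also have "\<dots> = \<bar>\<sigma>\<bar> / (4 * m) * (\<Sum>k<n. \<epsilon> k) + \<bar>a\<bar> * B * \<eta> / (2 * m) * T"
    proof -
      have "(\<Sum>k<n. \<bar>a\<bar> * B * \<eta> / (2 * m) * (T / n)) = \<bar>a\<bar> * B * \<eta> / (2 * m) * T"
        using n0 by simp
      then show ?thesis by (simp only: sum.distrib sum_distrib_left[symmetric])
    qed
    also have "\<dots> \<le> \<bar>\<sigma>\<bar> / (4 * m) * (2 * \<eta>) + \<bar>a\<bar> * B * \<eta> / (2 * m) * T"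
      using eps m by (intro add_right_mono mult_left_mono) auto
    also have "\<dots> = C * \<eta>" using m by (simp add: C_def field_simps)
    finally show ?thesis .
  qed
  have "\<bar>L\<bar> \<le> e" if "e > 0" for e
  proof -
    \<comment> \<open>Dividing by \<open>C + 1\<close> instead of \<open>C\<close> covers the case
      \<open>C = 0\<close>.\<close>
    have "\<bar>L\<bar> \<le> C * (e / (C + 1))" using bound[of "e / (C + 1)"] that C by simp
    also have "\<dots> \<le> e" using that C by (simp add: field_simps)
    finally show ?thesis .
  qed
  then have "L = 0" by (metis abs_le_zero_iff dense_ge)
  then show ?thesis by (simp add: L_def z_def y_def algebra_simps diff_divide_distrib)
qed

section \<open>Existence and uniqueness for the Langevin equation with a continuous driver\<close>

lemma langevin_exists:
  fixes b :: "real \<Rightarrow> real"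
  assumes cont: "continuous_on {0..} b" and b0: "b 0 = 0"
  shows "langevin_path a \<sigma> y0 b \<infinity>
    (\<lambda>t. exp (a * t) * (y0 + \<sigma> * a * integral {0..t} (\<lambda>s. exp (- a * s) * b s)) + \<sigma> * b t)"
    (is "langevin_path _ _ _ _ _ ?Z")
proof -
  \<comment> \<open>The candidate is variation of constants with the integral against
    \<open>b\<close> integrated by parts, so continuity of \<open>b\<close> suffices. Although
    \<open>b\<close> need not be differentiable, \<open>u\<close> is, with derivative
    \<open>a * ?Z\<close>.\<close>
  define u where "u t = exp (a * t) * (y0 + \<sigma> * a * integral {0..t} (\<lambda>s. exp (- a * s) * b s))" for t
  have Z: "?Z = (\<lambda>t. u t + \<sigma> * b t)" by (simp add: u_def)
  have du: "(u has_real_derivative a * ?Z s) (at s within {0..T})" if s: "s \<in> {0..T}" for s T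
  proof -
    have "continuous_on {0..T} (\<lambda>s. exp (- a * s) * b s)"
      by (intro continuous_intros continuous_on_subset[OF cont]) auto
    note d = integral_has_real_derivative[OF this s]
    have e: "exp (a * s) * exp (- (a * s)) = (1::real)" by (simp flip: exp_add)
    show ?thesis unfolding u_def
      by (rule derivative_eq_intros refl d)+ (use e in \<open>simp add: algebra_simps\<close>)
  qed
  have "u 0 = y0" by (simp add: u_def)
  have ucont: "continuous_on {0..T} u" for T
    by (rule DERIV_continuous_on) (rule du)
  have Zcont: "continuous_on {0..T} ?Z" for T
    unfolding Z by (intro continuous_intros ucont continuous_on_subset[OF cont]) auto
  have "continuous_on {0..} ?Z"
  proof (subst continuous_on_eq_continuous_within, intro ballI)
    fix t :: real assume t: "t \<in> {0..}"
    have "continuous (at t within {0..t + 1}) ?Z"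
      using Zcont[of "t + 1"] t by (auto simp: continuous_on_eq_continuous_within)
    \<comment> \<open>Continuity at \<open>t\<close> is local, so it carries over from the compact
      interval to the half-line.\<close>
    moreover have "at t within {0..t + 1} = at t within {0..}"
      by (rule at_within_nhd[of _ "{..<t + 1}"]) auto
    ultimately show "continuous (at t within {0..}) ?Z" by simp
  qed
  moreover have "?Z t = y0 + a * integral {0..t} ?Z + \<sigma> * b t" if "0 \<le> t" for t
  proof -
    have "((\<lambda>s. a * ?Z s) has_integral (u t - u 0)) {0..t}"
      using du by (intro fundamental_theorem_of_calculus that)
        (auto simp flip: has_real_derivative_iff_has_vector_derivative)
    from integral_unique[OF this] have "a * integral {0..t} ?Z = u t - u 0"
      by (simp only: Henstock_Kurzweil_Integration.integral_mult_right)
    moreover have "?Z t = u t + \<sigma> * b t" by (simp add: u_def)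
    ultimately show ?thesis using \<open>u 0 = y0\<close> by linarith
  qed
  moreover have "{t. 0 \<le> t \<and> ereal t < \<infinity>} = {0..}" by auto
  ultimately show ?thesis using b0 by (simp add: langevin_path_def)
qed

text \<open>The noise cancels in the difference \<open>D\<close>, leaving
  \<open>D s = a * integral {0..s} D\<close>. Multiplying the right-hand side by the integrating
  factor \<open>exp (- a * s)\<close> gives a function with zero derivative that starts at zero. The
  two horizons may differ, so a global solution can be compared with one that stops.\<close>

lemma langevin_unique:
  assumes y: "langevin_path a \<sigma> y0 b \<tau> y" and z: "langevin_path a \<sigma> y0 b \<tau>' z"
    and t: "0 \<le> t" "ereal t < \<tau>" "ereal t < \<tau>'"
  shows "y t = z t"
proof -
  have lt: "ereal s < \<tau>" "ereal s < \<tau>'" if "s \<in> {0..t}" for s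
  proof -
    have "ereal s \<le> ereal t" using that by simp
    then show "ereal s < \<tau>" "ereal s < \<tau>'"
      using order_le_less_trans t(2,3) by blast+
  qed
  have yc: "continuous_on {0..t} y" and zc: "continuous_on {0..t} z"
  proof -
    have "{0..t} \<subseteq> {s. 0 \<le> s \<and> ereal s < \<tau>}" "{0..t} \<subseteq> {s. 0 \<le> s \<and> ereal s < \<tau>'}"
      using lt by auto
    then show "continuous_on {0..t} y" "continuous_on {0..t} z"
      using y z unfolding langevin_path_def by (meson continuous_on_subset)+
  qed
  define D where "D s = y s - z s" for s
  have Dc: "continuous_on {0..t} D" unfolding D_def by (intro continuous_intros yc zc)
  have D: "D s = a * integral {0..s} D" if s: "s \<in> {0..t}" for s
  proof -
    have 1: "y s = y0 + a * integral {0..s} y + \<sigma> * b s" "z s = y0 + a * integral {0..s} z + \<sigma> * b s"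
      using y z s lt[OF s] unfolding langevin_path_def by auto
    have 2: "integral {0..s} D = integral {0..s} y - integral {0..s} z"
      unfolding D_def using s
      by (intro Henstock_Kurzweil_Integration.integral_diff integrable_continuous_real
          continuous_on_subset[OF yc] continuous_on_subset[OF zc]) auto
    show ?thesis unfolding 2 using 1 by (simp add: D_def algebra_simps)
  qed
  have dD: "((\<lambda>r. exp (- a * r) * (a * integral {0..r} D)) has_real_derivative 0) (at s within {0..t})"
    if s: "s \<in> {0..t}" for s
    by (rule derivative_eq_intros refl integral_has_real_derivative[OF Dc s])+
      (use D[OF s] in \<open>simp add: algebra_simps\<close>)
  obtain c where "\<And>s. s \<in> {0..t} \<Longrightarrow> exp (- a * s) * (a * integral {0..s} D) = c"
    using has_field_derivative_zero_constant[OF convex_real_interval(5) dD] by blast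
  from this[of 0] this[of t] have "a * integral {0..t} D = 0" using t(1) by simp
  then have "D t = 0" using D[of t] t(1) by simp
  then show ?thesis by (simp add: D_def)
qed

section \<open>Measurability of path integrals, and fractional Brownian motion at time zero\<close>

lemma borel_measurable_path_integral:
  fixes f :: "real \<Rightarrow> 'w \<Rightarrow> real"
  assumes meas: "\<And>t. t \<in> {0..T} \<Longrightarrow> f t \<in> borel_measurable M"
    and cont: "\<And>w. w \<in> space M \<Longrightarrow> continuous_on {0..T} (\<lambda>t. f t w)"
    and T: "0 \<le> T"
  shows "(\<lambda>w. integral {0..T} (\<lambda>t. f t w)) \<in> borel_measurable M"
proof (rule borel_measurable_LIMSEQ_real)
  \<comment> \<open>Left Riemann sums converge for each \<open>w\<close> by path continuity, and
    each is measurable from measurability at fixed times. Using \<open>Suc n\<close> intervals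
    avoids an empty grid at \<open>n = 0\<close>.\<close>
  define t where "t n k = real k * (T / real (Suc n))" for n k
  have step: "t n (Suc k) - t n k = T / Suc n" for n k
    by (simp only: t_def left_diff_distrib[symmetric]) simp
  have t0: "t n 0 = 0" and tn: "t n (Suc n) = T" for n by (auto simp: t_def)
  have inc: "t n k \<le> t n (Suc k)" for n k
  proof -
    have "0 \<le> T / Suc n" using T by simp
    then show ?thesis using step[of n k] by linarith
  qed
  have tin: "t n k \<in> {0..T}" if "k \<le> Suc n" for n k
  proof -
    have "real k * (T / real (Suc n)) \<le> real (Suc n) * (T / real (Suc n))"
      using that T by (intro mult_right_mono) auto
    then show ?thesis using T by (simp add: t_def)
  qed
  show "(\<lambda>w. \<Sum>k<Suc n. f (t n k) w * (T / Suc n)) \<in> borel_measurable M" for n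
    using tin[of _ n] by (intro borel_measurable_sum borel_measurable_times meas) auto
  fix w assume w: "w \<in> space M"
  define h where "h = (\<lambda>s. f s w)"
  have hc: "continuous_on {0..T} h" unfolding h_def using cont[OF w] .
  show "(\<lambda>n. \<Sum>k<Suc n. f (t n k) w * (T / Suc n)) \<longlonglongrightarrow> integral {0..T} (\<lambda>t. f t w)"
  proof (rule LIMSEQ_I)
    fix e :: real assume e: "e > 0"
    \<comment> \<open>The denominator \<open>T + 1\<close> gives \<open>T * \<eta> < e\<close> also
      for \<open>T = 0\<close>.\<close>
    define \<eta> where "\<eta> = e / (T + 1)"
    have eta: "\<eta> > 0" "T * \<eta> < e" using e T by (auto simp: \<eta>_def field_simps)
    obtain d where d: "d > 0"
      and U: "\<And>s u. s \<in> {0..T} \<Longrightarrow> u \<in> {0..T} \<Longrightarrow> \<bar>s - u\<bar> < d \<Longrightarrow> \<bar>h s - h u\<bar> < \<eta>"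
      using uniform_modulus[OF hc eta(1)] by blast
    obtain N :: nat where N: "T / d < real N" using reals_Archimedean2 by blast
    have "\<bar>(\<Sum>k<Suc n. h (t n k) * (T / Suc n)) - integral {0..T} h\<bar> < e" if n: "n \<ge> N" for n
    proof -
      have "T < real N * d" using N d by (simp add: field_simps)
      also have "\<dots> \<le> real (Suc n) * d" using n d by (intro mult_right_mono) auto
      finally have mesh: "T / Suc n < d" by (simp add: field_simps)
      have loc: "\<bar>h (t n k) * (T / Suc n) - integral {t n k..t n (Suc k)} h\<bar> \<le> \<eta> * (T / Suc n)"
        if k: "k < Suc n" for k
      proof -
        have in1: "t n k \<in> {0..T}" and in2: "t n (Suc k) \<in> {0..T}" using tin k by auto
        have sub: "{t n k..t n (Suc k)} \<subseteq> {0..T}" using in1 in2 by auto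
        note c = continuous_on_subset[OF hc sub]
        have "integral {t n k..t n (Suc k)} (\<lambda>s. h (t n k) - h s)
            = h (t n k) * (T / Suc n) - integral {t n k..t n (Suc k)} h"
          using c inc[of n k] step[of n k]
          by (subst Henstock_Kurzweil_Integration.integral_diff) (auto intro!: integrable_continuous_real)
        moreover have "\<bar>h (t n k) - h s\<bar> \<le> \<eta>" if s: "s \<in> {t n k..t n (Suc k)}" for s
        proof (intro less_imp_le U in1)
          show "s \<in> {0..T}" using s sub by auto
          show "\<bar>t n k - s\<bar> < d" using s step[of n k] mesh by auto
        qed
        moreover have "continuous_on {t n k..t n (Suc k)} (\<lambda>s. h (t n k) - h s)"
          by (intro continuous_intros c)
        ultimately show ?thesis
          using integral_bound[of "t n k" "t n (Suc k)" "\<lambda>s. h (t n k) - h s" \<eta>] inc[of n k] step[of n k]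
          by auto
      qed
      have "integral {0..T} h = (\<Sum>k<Suc n. integral {t n k..t n (Suc k)} h)"
        using integral_grid[of "t n" "Suc n" h] hc inc t0[of n] tn[of n] by simp
      then have "\<bar>(\<Sum>k<Suc n. h (t n k) * (T / Suc n)) - integral {0..T} h\<bar>
          = \<bar>\<Sum>k<Suc n. h (t n k) * (T / Suc n) - integral {t n k..t n (Suc k)} h\<bar>"
        by (simp only: sum_subtractf)
      also have "\<dots> \<le> (\<Sum>k<Suc n. \<eta> * (T / Suc n))"
        using loc by (intro order_trans[OF sum_abs] sum_mono) auto
      also have "\<dots> = T * \<eta>" by (simp del: of_nat_Suc sum.lessThan_Suc)
      finally show ?thesis using eta by simp
    qed
    then show "\<exists>N. \<forall>n\<ge>N. norm ((\<Sum>k<Suc n. f (t n k) w * (T / Suc n)) - integral {0..T} (\<lambda>t. f t w)) < e"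
      unfolding h_def real_norm_def by blast
  qed
qed

lemma fractional_brownian_motion_gaussian:
  assumes "fractional_brownian_motion M H B" "0 \<le> t"
  shows "gaussian_rv M (B t)"
proof -
  have "gaussian_process M B" using assms unfolding fractional_brownian_motion_def by blast
  then have "gaussian_rv M (\<lambda>w. \<Sum>s\<in>{t}. (\<lambda>_. 1) s * B s w)"
    unfolding gaussian_process_def using assms(2)
    by (elim allE[of _ "{t}"] allE[of _ "\<lambda>_. 1"]) auto
  then show ?thesis by simp
qed

text \<open>Mean and second moment vanish at time zero. A nondegenerate normal law would have
  positive variance, so a point mass remains, and its mean places it at zero. The Gaussian dichotomy
  matters: \<open>expectation\<close> defaults to zero for non-integrable functions, so a zero
  second moment alone proves nothing.\<close>

lemma fractional_brownian_motion_at_0: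
  assumes fbm: "fractional_brownian_motion M H B"
  shows "AE w in M. B 0 w = 0"
proof -
  interpret prob_space M using fbm by (simp add: fractional_brownian_motion_def)
  have E: "expectation (B 0) = 0" and V: "expectation (\<lambda>w. B 0 w * B 0 w) = 0"
    using fbm unfolding fractional_brownian_motion_def by auto
  have "gaussian_rv M (B 0)" using fractional_brownian_motion_gaussian[OF fbm] by simp
  then consider \<mu> s where "s > 0" "distributed M lborel (B 0) (normal_density \<mu> s)"
    | \<mu> where "AE w in M. B 0 w = \<mu>" "B 0 \<in> borel_measurable M"
    unfolding gaussian_rv_def by blast
  then show ?thesis
  proof cases
    case 1
    have "variance (B 0) = s\<^sup>2" using normal_distributed_variance[OF 1] .
    then show ?thesis using E V \<open>s > 0\<close> by (simp add: power2_eq_square)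
  next
    case 2
    have "expectation (B 0) = expectation (\<lambda>_. \<mu>)" using 2 by (intro integral_cong_AE) auto
    then have "\<mu> = 0" using E by (simp add: prob_space)
    then show ?thesis using 2 by simp
  qed
qed

section \<open>The square root of the solution up to its first zero\<close>

lemma sqrt_sde_path_pos:
  assumes x: "sqrt_sde_path a \<sigma> x0 b x" and x0: "x0 > 0"
    and t: "0 \<le> t" "ereal t < first_zero x"
  shows "x t > 0"
proof (rule ccontr)
  assume "\<not> x t > 0"
  have xc: "continuous_on {0..t} x"
    using x t unfolding sqrt_sde_path_def
    by (auto elim!: continuous_on_subset intro: order_le_less_trans[of _ "ereal t"])
  have x00: "x 0 > 0" using x x0 by (simp add: sqrt_sde_path_def)
  \<comment> \<open>A nonpositive value at \<open>t\<close> forces a zero in \<open>{0..t}\<close>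
    by the intermediate value theorem. Since \<open>x 0 > 0\<close> it occurs at a positive time and
    hence counts for \<open>first_zero\<close>.\<close>
  obtain s where s: "0 \<le> s" "s \<le> t" "x s = 0"
    using IVT2'[of x t 0 0] \<open>\<not> x t > 0\<close> x00 t xc by auto
  then have "0 < s" using x00 by (cases "s = 0") auto
  then have "first_zero x \<le> ereal s" unfolding first_zero_def using s by (intro Inf_lower) auto
  also have "\<dots> \<le> ereal t" using s by simp
  finally show False using t by simp
qed

lemma sqrt_sde_path_langevin:
  assumes x: "sqrt_sde_path a \<sigma> x0 b x" and x0: "x0 > 0" and b0: "b 0 = 0"
  shows "langevin_path (a / 2) (\<sigma> / 2) (sqrt x0) b (first_zero x) (\<lambda>t. sqrt (x t))"
  unfolding langevin_path_def
proof (intro conjI allI impI)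
  show "sqrt (x 0) = sqrt x0" using x by (simp add: sqrt_sde_path_def)
  show "continuous_on {t. 0 \<le> t \<and> ereal t < first_zero x} (\<lambda>t. sqrt (x t))"
    using x by (auto simp: sqrt_sde_path_def intro!: continuous_intros)
  fix T assume T: "0 \<le> T \<and> ereal T < first_zero x"
  have dom: "0 \<le> t \<and> ereal t < first_zero x" if "t \<in> {0..T}" for t
  proof -
    have "ereal t \<le> ereal T" using that by simp
    also have "\<dots> < first_zero x" using T by simp
    finally show ?thesis using that by simp
  qed
  have "\<exists>I. has_rs_integral (\<lambda>s. sqrt (x s)) b 0 t I \<and> x t = x0 + a * integral {0..t} x + \<sigma> * I"
    if "t \<in> {0..T}" for t
    using x dom[OF that] unfolding sqrt_sde_path_def by simp
  \<comment> \<open>The Henstock estimate uses the integral up to every grid point, so its values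
    are chosen as one function on \<open>{0..T}\<close>.\<close>
  then obtain J where J: "\<And>t. t \<in> {0..T} \<Longrightarrow> has_rs_integral (\<lambda>s. sqrt (x s)) b 0 t (J t) \<and>
      x t = x0 + a * integral {0..t} x + \<sigma> * J t"
    by metis
  have "continuous_on {0..T} x"
    using x dom unfolding sqrt_sde_path_def by (blast intro: continuous_on_subset)
  moreover have "x t > 0" if "t \<in> {0..T}" for t
    using sqrt_sde_path_pos[OF x x0] dom[OF that] by blast
  ultimately have "sqrt (x T) - sqrt (x 0) = a / 2 * integral {0..T} (\<lambda>s. sqrt (x s)) + \<sigma> / 2 * (b T - b 0)"
    using J T by (intro sqrt_of_rs_equation[where J = J and c = x0]) blast+
  then show "sqrt (x T) = sqrt x0 + a / 2 * integral {0..T} (\<lambda>t. sqrt (x t)) + \<sigma> / 2 * b T"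
    using x b0 by (simp add: sqrt_sde_path_def)
qed

text \<open>The explicit Langevin solution is taken for each \<open>w\<close>. It is measurable
  because its path integral is, and it solves the equation almost surely because
  \<open>B 0 = 0\<close> holds almost surely.\<close>

lemma fractional_OU_exists:
  assumes fbm: "fractional_brownian_motion M H B"
  shows "\<exists>Z. fractional_OU M a \<sigma> y0 B Z"
proof -
  define Z where "Z t w =
    exp (a * t) * (y0 + \<sigma> * a * integral {0..t} (\<lambda>s. exp (- a * s) * B s w)) + \<sigma> * B t w"
    for t w
  have cont: "continuous_on {0..} (\<lambda>t. B t w)" if "w \<in> space M" for w
    using fbm that by (simp add: fractional_brownian_motion_def)
  have meas: "B t \<in> borel_measurable M" if "0 \<le> t" for t
    using fractional_brownian_motion_gaussian[OF fbm that] by (simp add: gaussian_rv_def)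
  have "Z t \<in> borel_measurable M" if "0 \<le> t" for t
  proof -
    have "(\<lambda>w. integral {0..t} (\<lambda>s. exp (- a * s) * B s w)) \<in> borel_measurable M"
      using meas that
      by (intro borel_measurable_path_integral)
        (auto intro!: continuous_intros continuous_on_subset[OF cont])
    then show ?thesis unfolding Z_def using meas[OF that] by measurable
  qed
  moreover have "AE w in M. langevin_path a \<sigma> y0 (\<lambda>t. B t w) \<infinity> (\<lambda>t. Z t w)"
    using fractional_brownian_motion_at_0[OF fbm] AE_space
    by eventually_elim (use langevin_exists cont in \<open>simp add: Z_def\<close>)
  ultimately show ?thesis unfolding fractional_OU_def by blast
qed

theorem mainTheorem1:
  fixes M :: "'w measure"
    and B X :: "real \<Rightarrow> 'w \<Rightarrow> real"
    and H a' \<sigma>' x0 a \<sigma> :: real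
  assumes H: "2 / 3 < H" "H < 1"
    and sigma_pos: "\<sigma>' > 0"
    and x0_pos: "x0 > 0"
    and fbm: "fractional_brownian_motion M H B"
    and sol: "sqrt_sde_solution M a' \<sigma>' x0 B X"
    and a_eq: "a = a' / 2"
    and sigma_eq: "\<sigma> = \<sigma>' / 2"
  shows "(AE w in M. langevin_path a \<sigma> (sqrt x0) (\<lambda>t. B t w)
            (first_zero (\<lambda>t. X t w)) (\<lambda>t. sqrt (X t w))) \<and>
         (\<exists>Z. fractional_OU M a \<sigma> (sqrt x0) B Z) \<and>
         (\<forall>Z. fractional_OU M a \<sigma> (sqrt x0) B Z \<longrightarrow>
            (AE w in M. \<forall>t. 0 \<le> t \<and> ereal t < first_zero (\<lambda>t. X t w) \<longrightarrow>
               X t w = (Z t w)\<^sup>2))"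
proof (intro conjI allI impI)
  have path: "AE w in M. sqrt_sde_path a' \<sigma>' x0 (\<lambda>t. B t w) (\<lambda>t. X t w)"
    using sol by (simp add: sqrt_sde_solution_def)
  show lang: "AE w in M. langevin_path a \<sigma> (sqrt x0) (\<lambda>t. B t w)
            (first_zero (\<lambda>t. X t w)) (\<lambda>t. sqrt (X t w))"
    using path fractional_brownian_motion_at_0[OF fbm]
    by eventually_elim (simp add: a_eq sigma_eq sqrt_sde_path_langevin x0_pos)
  \<comment> \<open>Existence keeps the statement about all \<open>Z\<close> from being
    vacuous.\<close>
  show "\<exists>Z. fractional_OU M a \<sigma> (sqrt x0) B Z" using fractional_OU_exists[OF fbm] .
  fix Z assume "fractional_OU M a \<sigma> (sqrt x0) B Z"
  then have "AE w in M. langevin_path a \<sigma> (sqrt x0) (\<lambda>t. B t w) \<infinity> (\<lambda>t. Z t w)"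
    by (simp add: fractional_OU_def)
  then show "AE w in M. \<forall>t. 0 \<le> t \<and> ereal t < first_zero (\<lambda>t. X t w) \<longrightarrow> X t w = (Z t w)\<^sup>2"
    using path lang
  proof eventually_elim
    case (elim w)
    show ?case
    proof (intro allI impI)
      fix t assume t: "0 \<le> t \<and> ereal t < first_zero (\<lambda>t. X t w)"
      \<comment> \<open>The path of \<open>Z\<close> solves the equation for all times and
        \<open>sqrt (X t w)\<close> up to the first zero; the exceptional null set does not depend
        on \<open>t\<close>.\<close>
      have "sqrt (X t w) = Z t w" using langevin_unique[OF elim(3,1), of t] t by simp
      moreover have "X t w > 0" using sqrt_sde_path_pos[OF elim(2) x0_pos] t by simp
      \<comment> \<open>Positivity is essential: \<open>sqrt\<close> is also defined at negative
        numbers, where squaring does not undo it.\<close>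
      ultimately show "X t w = (Z t w)\<^sup>2" by (metis less_imp_le real_sqrt_pow2)
    qed
  qed
qed

end
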